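(* Let $\Gamma_1>\Gamma_2>0$ and $C\in\mathbb R$, and put $q=e^{-\pi/2}$. Let the reduced Hamiltonian $\mathcal H(X,y_1)$, for $X=x_1-x_2\in[-\pi,\pi]$ (considered $2\pi$-periodically) and $y_1\in\mathbb R$, be obtained by substituting $y_2=\frac{C-\Gamma_1y_1}{\Gamma_2}$ into $$\mathcal H=-\frac{\Gamma_1\Gamma_2}{2\pi}\log\Big|\theta_1\Big(\frac{X+i(y_1-y_2)}2,q\Big)\Big|+\frac{\Gamma_1\Gamma_2}{2\pi}\log\Big|\theta_2\Big(\frac{X+i(y_1+y_2)}2,q\Big)\Big|-\frac{\Gamma_1\Gamma_2}{\pi^2}y_1y_2$$ $$\qquad+\frac{\Gamma_1^2}{4\pi}\Big(\log\Big|\theta_1\Big(iy_1-\frac\pi2,q\Big)\Big|-\frac{2y_1^2}\pi\Big)+\frac{\Gamma_2^2}{4\pi}\Big(\log\Big|\theta_1\Big(iy_2-\frac\pi2,q\Big)\Big|-\frac{2y_2^2}\pi\Big).$$ Then all critical points of the reduced Hamiltonian lie on the lines $X=x_1-x_2=0,\pm\pi$.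
   Context: $\theta_1(z,q)=2\sum_{n\ge0}(-1)^nq^{(n+1/2)^2}\sin((2n+1)z)$ and $\theta_2(z,q)=2\sum_{n\ge0}q^{(n+1/2)^2}\cos((2n+1)z)$ are Jacobi theta functions. $\mathcal H$ is the Hamiltonian of two point vortices with strengths $\Gamma_1,\Gamma_2$ at $x_j+iy_j$ on the Klein bottle, and $C=\Gamma_1y_1+\Gamma_2y_2$ is its constant of motion. Critical points are points $(X,y_1)$ at which $\mathcal H$ is finite and both partial derivatives vanish. *)

theory Defs
  imports Complex_Main
begin

text \<open>The theta functions are taken for a real nome in the open interval from 0 to 1, where
  \<open>q powr a\<close> is the usual real power and both series converge for every complex \<open>z\<close>.\<close>

definition jacobi_theta1 :: "complex \<Rightarrow> real \<Rightarrow> complex" where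
  "jacobi_theta1 z q =
     2 * (\<Sum>n. (-1) ^ n * of_real (q powr ((real n + 1/2)\<^sup>2)) * sin (of_nat (2 * n + 1) * z))"

definition jacobi_theta2 :: "complex \<Rightarrow> real \<Rightarrow> complex" where
  "jacobi_theta2 z q =
     2 * (\<Sum>n. of_real (q powr ((real n + 1/2)\<^sup>2)) * cos (of_nat (2 * n + 1) * z))"

text \<open>The Hamiltonian of two vortices as a function of \<open>X = x\<^sub>1 - x\<^sub>2\<close>, \<open>y\<^sub>1\<close>, \<open>y\<^sub>2\<close>.  It is defined for
  all real \<open>X\<close> by the same formula, which is \<open>2\<pi>\<close>-periodic in \<open>X\<close>.\<close>

definition klein_hamiltonian ::
    "real \<Rightarrow> real \<Rightarrow> real \<Rightarrow> real \<Rightarrow> real \<Rightarrow> real \<Rightarrow> real" where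
  "klein_hamiltonian q \<Gamma>\<^sub>1 \<Gamma>\<^sub>2 X y\<^sub>1 y\<^sub>2 =
     - (\<Gamma>\<^sub>1 * \<Gamma>\<^sub>2 / (2 * pi)) * ln (cmod (jacobi_theta1 (Complex X (y\<^sub>1 - y\<^sub>2) / 2) q))
     + (\<Gamma>\<^sub>1 * \<Gamma>\<^sub>2 / (2 * pi)) * ln (cmod (jacobi_theta2 (Complex X (y\<^sub>1 + y\<^sub>2) / 2) q))
     - (\<Gamma>\<^sub>1 * \<Gamma>\<^sub>2 / pi\<^sup>2) * y\<^sub>1 * y\<^sub>2
     + (\<Gamma>\<^sub>1\<^sup>2 / (4 * pi)) *
         (ln (cmod (jacobi_theta1 (\<i> * of_real y\<^sub>1 - of_real (pi / 2)) q)) - 2 * y\<^sub>1\<^sup>2 / pi)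
     + (\<Gamma>\<^sub>2\<^sup>2 / (4 * pi)) *
         (ln (cmod (jacobi_theta1 (\<i> * of_real y\<^sub>2 - of_real (pi / 2)) q)) - 2 * y\<^sub>2\<^sup>2 / pi)"

text \<open>In HOL \<open>ln 0\<close> is a real number, so finiteness of the Hamiltonian has to be expressed through
  the arguments of its four logarithms.  Infinite terms never cancel: for \<open>q = exp (- pi / 2)\<close> the
  self-interaction terms are always finite, and the two pair-interaction terms are infinite only
  for \<open>X\<close> in \<open>2\<pi>\<int>\<close> and in \<open>\<pi> + 2\<pi>\<int>\<close>, respectively.\<close>

definition klein_hamiltonian_finite :: "real \<Rightarrow> real \<Rightarrow> real \<Rightarrow> real \<Rightarrow> bool" where
  "klein_hamiltonian_finite q X y\<^sub>1 y\<^sub>2 \<longleftrightarrow>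
     jacobi_theta1 (Complex X (y\<^sub>1 - y\<^sub>2) / 2) q \<noteq> 0 \<and>
     jacobi_theta2 (Complex X (y\<^sub>1 + y\<^sub>2) / 2) q \<noteq> 0 \<and>
     jacobi_theta1 (\<i> * of_real y\<^sub>1 - of_real (pi / 2)) q \<noteq> 0 \<and>
     jacobi_theta1 (\<i> * of_real y\<^sub>2 - of_real (pi / 2)) q \<noteq> 0"

text \<open>On the level set \<open>\<Gamma>\<^sub>1 y\<^sub>1 + \<Gamma>\<^sub>2 y\<^sub>2 = C\<close> the coordinate \<open>y\<^sub>2\<close> is a function of \<open>y\<^sub>1\<close>.\<close>

definition reduced_y2 :: "real \<Rightarrow> real \<Rightarrow> real \<Rightarrow> real \<Rightarrow> real" where
  "reduced_y2 \<Gamma>\<^sub>1 \<Gamma>\<^sub>2 C y\<^sub>1 = (C - \<Gamma>\<^sub>1 * y\<^sub>1) / \<Gamma>\<^sub>2"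

definition reduced_hamiltonian ::
    "real \<Rightarrow> real \<Rightarrow> real \<Rightarrow> real \<Rightarrow> real \<Rightarrow> real \<Rightarrow> real" where
  "reduced_hamiltonian q \<Gamma>\<^sub>1 \<Gamma>\<^sub>2 C X y\<^sub>1 =
     klein_hamiltonian q \<Gamma>\<^sub>1 \<Gamma>\<^sub>2 X y\<^sub>1 (reduced_y2 \<Gamma>\<^sub>1 \<Gamma>\<^sub>2 C y\<^sub>1)"

definition reduced_critical_point ::
    "real \<Rightarrow> real \<Rightarrow> real \<Rightarrow> real \<Rightarrow> real \<Rightarrow> real \<Rightarrow> bool" where
  "reduced_critical_point q \<Gamma>\<^sub>1 \<Gamma>\<^sub>2 C X y\<^sub>1 \<longleftrightarrow>
     klein_hamiltonian_finite q X y\<^sub>1 (reduced_y2 \<Gamma>\<^sub>1 \<Gamma>\<^sub>2 C y\<^sub>1) \<and>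
     ((\<lambda>t. reduced_hamiltonian q \<Gamma>\<^sub>1 \<Gamma>\<^sub>2 C t y\<^sub>1) has_real_derivative 0) (at X) \<and>
     ((\<lambda>t. reduced_hamiltonian q \<Gamma>\<^sub>1 \<Gamma>\<^sub>2 C X t) has_real_derivative 0) (at y\<^sub>1)"

end

(*
  Only the X-derivative matters. For q in (0,1) and x = q^2, the Jacobi triple product (obtained
  here as the limit of a finite identity for Gaussian binomial coefficients) gives
    |theta_1((X + iu)/2)|^2 = (cosh u - cos X) F_u(cos X)
  where F_u is positive and decreasing on (-1,1): it is a constant times the product over k >= 1 of
  (1 - 2 e^u x^k c + e^(2u) x^(2k)) (1 - 2 e^(-u) x^k c + e^(-2u) x^(2k)), each factor being decreasing in c.
  Since theta_2(z) = theta_1(z + pi/2), the Hamiltonian is, as a function of X,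
  - (Gamma_1 Gamma_2 / 4 pi) ln (cosh u - cos X) plus an increasing function of cos X. The two
  contributions to the derivative have the same sign, and the first one vanishes only for sin X = 0.
*)

theory Submission
  imports Defs "HOL-Analysis.Analysis"
begin

section \<open>Euler products and Gaussian binomial coefficients of odd order\<close>

definition q_pochhammer :: "real \<Rightarrow> nat \<Rightarrow> real" where
  "q_pochhammer x n = (\<Prod>k<n. 1 - x ^ Suc k)"

lemma q_pochhammer_Suc: "q_pochhammer x (Suc n) = q_pochhammer x n * (1 - x ^ Suc n)"
  by (simp add: q_pochhammer_def)

text \<open>The Gaussian binomial coefficient of \<open>2n + 1\<close> over \<open>n - j\<close>.\<close>

definition odd_q_binomial :: "real \<Rightarrow> nat \<Rightarrow> nat \<Rightarrow> real" where
  "odd_q_binomial x n j =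
     (if j \<le> n then q_pochhammer x (2 * n + 1) / (q_pochhammer x (n - j) * q_pochhammer x (n + 1 + j))
      else 0)"

context
  fixes x :: real
  assumes x: "0 < x" "x < 1"
begin

lemma one_minus_power_pos: "0 < 1 - x ^ Suc n"
  using x power_Suc_less_one[of x n] by simp

lemma q_pochhammer_pos: "0 < q_pochhammer x n"
  unfolding q_pochhammer_def by (intro prod_pos ballI one_minus_power_pos)

lemma q_pochhammer_le_1: "q_pochhammer x n \<le> 1"
  unfolding q_pochhammer_def
  using x one_minus_power_pos by (intro prod_le_1) (auto intro: less_imp_le)

lemma decseq_q_pochhammer: "decseq (q_pochhammer x)"
proof (rule decseq_SucI)
  fix n
  have "q_pochhammer x n * (1 - x ^ Suc n) \<le> q_pochhammer x n * 1"
    using x q_pochhammer_pos[of n] by (intro mult_left_mono) auto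
  then show "q_pochhammer x (Suc n) \<le> q_pochhammer x n"
    by (simp add: q_pochhammer_Suc)
qed

text \<open>The sum of \<open>x ^ Suc k\<close> converges and no factor vanishes, so Euler's product
  has a positive value. Being the limit of a decreasing sequence, it also bounds every partial
  product from below; this later makes the estimates uniform in \<open>n\<close>.\<close>

lemma q_pochhammer_limit:
  obtains L where "0 < L" "q_pochhammer x \<longlonglongrightarrow> L" "\<And>n. L \<le> q_pochhammer x n"
proof -
  have "summable (\<lambda>k. \<bar>- (x ^ Suc k)\<bar>)"
    using x by (simp add: summable_mult abs_mult)
  then have conv: "convergent_prod (\<lambda>k. 1 + - (x ^ Suc k))"
    using one_minus_power_pos[THEN less_imp_neq] by (intro summable_imp_convergent_prod_real) auto
  define L where "L = prodinf (\<lambda>k. 1 + - (x ^ Suc k))"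
  have "0 < L"
    unfolding L_def using one_minus_power_pos by (intro less_0_prodinf[OF conv]) simp
  moreover have lim: "q_pochhammer x \<longlonglongrightarrow> L"
    using convergent_prod_LIMSEQ[OF conv]
    unfolding L_def q_pochhammer_def LIMSEQ_lessThan_iff_atMost by simp
  moreover have "L \<le> q_pochhammer x n" for n
    by (rule decseq_ge[OF decseq_q_pochhammer lim])
  ultimately show ?thesis by (rule that)
qed

text \<open>Coefficient comparison for one more factor of the triple product. The common factor
  \<open>x ^ j\<close> avoids the exponent n + 1 - j. At \<open>j = 0\<close> the truncated
  \<open>j - 1 = 0\<close> is correct: index -1 means 2n + 1 over n + 1, which by symmetry equals 2n
  + 1 over n.\<close>

lemma odd_q_binomial_rec:
  assumes "j \<le> Suc n"
  shows "x ^ j * odd_q_binomial x (Suc n) j =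
    x ^ j * (1 + x ^ (2 * n + 2)) * odd_q_binomial x n j +
    x ^ Suc n * (odd_q_binomial x n (j - 1) + x ^ (2 * j + 1) * odd_q_binomial x n (Suc j))"
proof -
  note nz = q_pochhammer_pos[THEN less_imp_neq, symmetric]
  have cancel: "d * (p / d') = p * e" if "d = d' * e" "d' \<noteq> 0" for d d' e p :: real
    using that by simp
  define m where "m = Suc n - j"
  define P where "P = q_pochhammer x (2 * n + 1)"
  \<comment> \<open>The denominator of \<open>odd_q_binomial x (Suc n) j\<close>; multiplying by it
    turns all four coefficients into \<open>P\<close> times a polynomial in
    \<open>x\<close>.\<close>
  define D where "D = q_pochhammer x m * q_pochhammer x (n + 2 + j)"
  have n: "Suc n = j + m" using assms by (simp add: m_def)
  have D0: "D \<noteq> 0" by (simp add: D_def nz)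
  have E1: "D * odd_q_binomial x (Suc n) j = P * (1 - x ^ (2 * n + 2)) * (1 - x ^ (2 * n + 3))"
  proof -
    have "odd_q_binomial x (Suc n) j = q_pochhammer x (Suc (Suc (2 * n + 1))) / D"
      using assms by (simp add: odd_q_binomial_def D_def m_def)
    then show ?thesis using D0
      by (simp only: q_pochhammer_Suc) (simp add: P_def numeral_eq_Suc)
  qed
  have E2: "D * odd_q_binomial x n j = P * ((1 - x ^ m) * (1 - x ^ (n + 2 + j)))"
  \<comment> \<open>For \<open>m = 0\<close>, that is \<open>j = Suc n\<close>, the default value 0
    agrees with the vanishing factor \<open>1 - x ^ m\<close>.\<close>
  proof (cases m)
    case 0
    then show ?thesis using n by (simp add: odd_q_binomial_def)
  next
    case (Suc k)
    have "D * (P / (q_pochhammer x k * q_pochhammer x (n + 1 + j)))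
        = P * ((1 - x ^ m) * (1 - x ^ (n + 2 + j)))"
      by (rule cancel, simp add: D_def Suc q_pochhammer_Suc) (simp add: nz)
    moreover have "n - j = k" "j \<le> n" using n Suc by auto
    ultimately show ?thesis by (simp add: odd_q_binomial_def P_def)
  qed
  have E3: "D * odd_q_binomial x n (Suc j) = P * ((1 - x ^ m) * (1 - x ^ (m - 1)))"
  \<comment> \<open>The default value 0 again fits: one of the two factors on the right is
    \<open>1 - x ^ 0\<close>.\<close>
  proof (cases "m \<le> 1")
    case True
    then have "m = 0 \<or> m = 1" by auto
    then show ?thesis using n by (auto simp: odd_q_binomial_def)
  next
    case False
    then obtain k where k: "m = Suc (Suc k)"
      by (metis One_nat_def le_SucI not0_implies_Suc le_refl zero_le)
    have "D * (P / (q_pochhammer x k * q_pochhammer x (n + 1 + Suc j)))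
        = P * ((1 - x ^ m) * (1 - x ^ (m - 1)))"
      by (rule cancel, simp add: D_def k q_pochhammer_Suc) (simp add: nz)
    moreover have "n - Suc j = k" "Suc j \<le> n" using n k by auto
    ultimately show ?thesis by (simp add: odd_q_binomial_def P_def)
  qed
  have E4: "D * odd_q_binomial x n (j - 1) = P * ((1 - x ^ (n + 1 + j)) *
      (1 - x ^ (n + 2 + j)))"
  proof (cases j)
    case 0
    have "D * (P / (q_pochhammer x n * q_pochhammer x (n + 1)))
        = P * ((1 - x ^ (n + 1)) * (1 - x ^ (n + 2)))"
      by (rule cancel, simp add: D_def m_def 0 q_pochhammer_Suc) (simp add: nz)
    then show ?thesis by (simp add: odd_q_binomial_def P_def m_def 0)
  next
    case (Suc i)
    have "D * (P / (q_pochhammer x m * q_pochhammer x (n + j)))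
        = P * ((1 - x ^ (n + 1 + j)) * (1 - x ^ (n + 2 + j)))"
      by (rule cancel, simp add: D_def q_pochhammer_Suc) (simp add: nz)
    moreover have "n - i = m" "i \<le> n" using n Suc by auto
    ultimately show ?thesis by (simp add: odd_q_binomial_def P_def Suc)
  qed
  have "D * (x ^ j * odd_q_binomial x (Suc n) j) =
      x ^ j * (D * odd_q_binomial x (Suc n) j)" by simp
  also have "\<dots> = x ^ j * (1 + x ^ (2 * n + 2)) * (D * odd_q_binomial x n j) +
    x ^ Suc n * (D * odd_q_binomial x n (j - 1) + x ^ (2 * j + 1) * (D * odd_q_binomial x n (Suc j)))"
  \<comment> \<open>The split removes the truncated \<open>m - 1\<close>; what remains is a
    polynomial identity in \<open>x\<close>, \<open>x ^ j\<close> and \<open>x ^ k\<close>.\<close>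
  proof (cases m)
    case 0
    then have "j = Suc n" using n by simp
    then show ?thesis unfolding E1 E2 E3 E4
      by (simp add: 0 power_add power_mult algebra_simps power2_eq_square numeral_eq_Suc)
  next
    case (Suc k)
    then have "n = j + k" using n by simp
    then show ?thesis unfolding E1 E2 E3 E4
      by (simp add: Suc power_add power_mult algebra_simps power2_eq_square numeral_eq_Suc)
  qed
  also have "\<dots> = D * (x ^ j * (1 + x ^ (2 * n + 2)) * odd_q_binomial x n j +
    x ^ Suc n * (odd_q_binomial x n (j - 1) + x ^ (2 * j + 1) * odd_q_binomial x n (Suc j)))"
    by (simp add: algebra_simps)
  finally show ?thesis using D0 by simp
qed

text \<open>The numerator is at most 1 and each Pochhammer factor below is at least
  \<open>L\<close>. A bound free of both \<open>n\<close> and \<open>j\<close> is what dominated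
  convergence of the sine sums requires.\<close>

lemma odd_q_binomial_bound:
  assumes "0 < L" "\<And>n. L \<le> q_pochhammer x n"
  shows "\<bar>odd_q_binomial x n j\<bar> \<le> 1 / L\<^sup>2"
proof (cases "j \<le> n")
  case True
  have "L * L \<le> q_pochhammer x (n - j) * q_pochhammer x (n + 1 + j)"
    using assms by (intro mult_mono) (auto intro: less_imp_le q_pochhammer_pos)
  then have "q_pochhammer x (2 * n + 1) / (q_pochhammer x (n - j) * q_pochhammer x (n + 1 + j))
      \<le> 1 / (L * L)"
    using assms(1) q_pochhammer_le_1 by (intro frac_le) auto
  then show ?thesis
    using True by (simp add: odd_q_binomial_def power2_eq_square abs_mult abs_of_pos q_pochhammer_pos)
qed (use assms in \<open>simp add: odd_q_binomial_def\<close>)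

lemma odd_q_binomial_LIMSEQ:
  assumes "0 < L" "q_pochhammer x \<longlonglongrightarrow> L"
  shows "(\<lambda>n. odd_q_binomial x n j) \<longlonglongrightarrow> 1 / L"
proof -
  have "strict_mono (\<lambda>n::nat. 2 * n + 1)" "strict_mono (\<lambda>n. n + 1 + j)"
    by (auto simp: strict_mono_def)
  note sub = this[THEN LIMSEQ_subseq_LIMSEQ[OF assms(2)], unfolded o_def]
  have "(\<lambda>n. q_pochhammer x (n - j)) \<longlonglongrightarrow> L"
    by (rule LIMSEQ_offset[where k = j]) (simp add: assms)
  then have "(\<lambda>n. q_pochhammer x (2 * n + 1) / (q_pochhammer x (n - j) * q_pochhammer x (n + 1 + j)))
      \<longlonglongrightarrow> L / (L * L)"
    using assms(1) by (intro tendsto_intros sub) auto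
  moreover have "\<forall>\<^sub>F n in sequentially.
      q_pochhammer x (2 * n + 1) / (q_pochhammer x (n - j) * q_pochhammer x (n + 1 + j))
        = odd_q_binomial x n j"
    using eventually_ge_at_top[of j] by eventually_elim (simp add: odd_q_binomial_def)
  ultimately show ?thesis
    using assms(1) by (simp add: tendsto_cong)
qed

end

section \<open>The finite triple product as a sine sum\<close>

text \<open>The coefficient of sin((2j+1)z) in the product of \<open>n\<close> factors. The exponent
  j(j+1) is (j+1/2)^2 - 1/4, so powers stay natural and the constant q^(1/4) is restored only in the
  limit.\<close>

definition theta_coeff :: "real \<Rightarrow> nat \<Rightarrow> nat \<Rightarrow> real" where
  "theta_coeff q n j = (-1) ^ j * q ^ (j * (j + 1)) * odd_q_binomial (q\<^sup>2) n j"

text \<open>This is multiplication by 1 - 2r cos 2z + r^2 with r = q^(2n+2), read off on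
  coefficients. Consecutive weights q^(j(j+1)) have quotient \<open>x ^ j\<close>, which accounts
  for the powers in \<open>odd_q_binomial_rec\<close>.\<close>

lemma theta_coeff_rec:
  fixes q :: real
  assumes q: "0 < q" "q < 1" and j: "j \<le> Suc n"
  shows "theta_coeff q (Suc n) j =
    (1 + (q\<^sup>2) ^ (2 * Suc n)) * theta_coeff q n j
      - (q\<^sup>2) ^ Suc n *
        (theta_coeff q n (Suc j) + (if j = 0 then - theta_coeff q n 0 else theta_coeff q n (j - 1)))"
proof -
  define x where "x = q\<^sup>2"
  have x: "0 < x" "x < 1"
    using q by (auto simp: x_def power_less_one_iff)
  note rec = odd_q_binomial_rec[OF x j]
  show ?thesis
  proof (cases j)
    case 0
    have c: "theta_coeff q m 0 = odd_q_binomial x m 0"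
      "theta_coeff q m (Suc 0) = - (x * odd_q_binomial x m (Suc 0))" for m
      by (simp_all add: theta_coeff_def x_def power2_eq_square)
    show ?thesis
      using rec unfolding 0 c x_def[symmetric] by (simp add: c algebra_simps)
  next
    case (Suc i)
    define w where "w = (-1) ^ i * q ^ (i * (i + 1))"
    have e: "Suc i * (Suc i + 1) = i * (i + 1) + 2 * Suc i"
      "Suc (Suc i) * (Suc (Suc i) + 1) = i * (i + 1) + 2 * Suc i + 2 * Suc (Suc i)"
      by (simp_all add: algebra_simps)
    have c: "theta_coeff q m i = w * odd_q_binomial x m i"
      "theta_coeff q m (Suc i) = - w * (x ^ Suc i * odd_q_binomial x m (Suc i))"
      "theta_coeff q m (Suc (Suc i)) = w * x ^ Suc i * x ^ Suc (Suc i) * odd_q_binomial x m (Suc (Suc i))"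
      for m
      unfolding theta_coeff_def w_def e power_add power_mult x_def by simp_all
    show ?thesis
      unfolding Suc c x_def[symmetric] rec[unfolded Suc]
      by (simp add: c algebra_simps power_add power_mult numeral_eq_Suc)
  qed
qed

text \<open>By the product-to-sum formula, 2 cos 2z moves the frequency 2j + 1 to 2j + 3 and 2j - 1.
  At \<open>j = 0\<close> the frequency -1 folds back onto 1 with a sign, whence
  \<open>- a 0\<close>.\<close>

lemma sum_odd_sin_times_cos:
  fixes a :: "nat \<Rightarrow> real" and z :: complex
  assumes "a (Suc n) = 0" "a (Suc (Suc n)) = 0"
  shows "(\<Sum>j\<le>n. of_real (a j) * sin (of_nat (2 * j + 1) * z)) * (2 * cos (2 * z)) =
    (\<Sum>j\<le>Suc n. of_real (a (Suc j) + (if j = 0 then - a 0 else a (j - 1))) * sin (of_nat (2 * j + 1) * z))"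
proof -
  define s where "s j = sin (of_nat (2 * j + 1) * z)" for j
  \<comment> \<open>The subtraction is complex, so \<open>t 0\<close> really is sin(-z).\<close>
  define t where "t j = sin ((of_nat (2 * j + 1) - 2) * z)" for j :: nat
  have prod: "s j * (2 * cos (2 * z)) = s (Suc j) + t j" for j
  proof -
    have "s (Suc j) = sin (of_nat (2 * j + 1) * z + 2 * z)"
      "t j = sin (of_nat (2 * j + 1) * z - 2 * z)"
      by (simp_all add: s_def t_def algebra_simps)
    then show ?thesis by (simp add: s_def sin_add sin_diff)
  qed
  have t0: "t 0 = - s 0" by (simp add: s_def t_def)
  have tS: "t (Suc j) = s j" for j by (simp add: s_def t_def algebra_simps)
  have "(\<Sum>j\<le>n. of_real (a j) * s j) * (2 * cos (2 * z)) =
      (\<Sum>j\<le>n. of_real (a j) * s (Suc j)) + (\<Sum>j\<le>n. of_real (a j) * t j)"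
    unfolding sum_distrib_right sum.distrib[symmetric]
    by (intro sum.cong refl) (simp only: mult.assoc prod distrib_left)
  \<comment> \<open>Two vanishing terms are appended so that, after the shift \<open>j\<close> to
    \<open>Suc j\<close>, the sum ends at \<open>Suc n\<close>.\<close>
  also have "(\<Sum>j\<le>n. of_real (a j) * t j) = (\<Sum>j\<le>Suc (Suc n). of_real (a j) * t j)"
    using assms by simp
  also have "\<dots> = - of_real (a 0) * s 0 + (\<Sum>j\<le>Suc n. of_real (a (Suc j)) * s j)"
    by (subst sum.atMost_Suc_shift) (simp add: t0 tS)
  also have "(\<Sum>j\<le>n. of_real (a j) * s (Suc j)) + (- of_real (a 0) * s 0 + (\<Sum>j\<le>Suc n. of_real (a (Suc j)) * s j))
    = (\<Sum>j\<le>Suc n. of_real (if j = 0 then - a 0 else a (j - 1)) * s j)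
      + (\<Sum>j\<le>Suc n. of_real (a (Suc j)) * s j)"
    by (subst (2) sum.atMost_Suc_shift) simp
  also have "\<dots> = (\<Sum>j\<le>Suc n. of_real (a (Suc j) + (if j = 0 then - a 0 else a (j - 1))) * s j)"
    unfolding sum.distrib[symmetric]
    by (intro sum.cong refl) (simp add: algebra_simps)
  finally show ?thesis by (simp add: s_def)
qed

text \<open>Each factor is (1 - r e^(2iz))(1 - r e^(-2iz)) with r = q^(2k+2). In the induction the
  new factor acts on the sine sum through \<open>sum_odd_sin_times_cos\<close>, and
  \<open>theta_coeff_rec\<close> identifies the resulting coefficients.\<close>

lemma finite_theta_product:
  fixes q :: real and z :: complex
  assumes q: "0 < q" "q < 1"
  shows "sin z * (\<Prod>k<n. 1 - of_real ((q\<^sup>2) ^ Suc k) * (2 * cos (2 * z)) + of_real (((q\<^sup>2) ^ Suc k)\<^sup>2))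
    = (\<Sum>j\<le>n. of_real (theta_coeff q n j) * sin (of_nat (2 * j + 1) * z))"
proof (induction n)
  case 0
  \<comment> \<open>Lets 1 - q^2 cancel in \<open>odd_q_binomial (q\<^sup>2) 0 0\<close>.\<close>
  have "q\<^sup>2 < 1" using q by (simp add: power_less_one_iff)
  then show ?case by (simp add: theta_coeff_def odd_q_binomial_def q_pochhammer_def)
next
  case (Suc n)
  define r where "r = (q\<^sup>2) ^ Suc n"
  define s where "s j = sin (of_nat (2 * j + 1) * z)" for j
  define a where "a = theta_coeff q n"
  have a0: "a j = 0" if "n < j" for j
    using that by (simp add: a_def theta_coeff_def odd_q_binomial_def)
  define b where "b j = (if j = 0 then - a 0 else a (j - 1))" for j
  have "sin z * (\<Prod>k<Suc n. 1 - of_real ((q\<^sup>2) ^ Suc k) * (2 * cos (2 * z)) + of_real (((q\<^sup>2) ^ Suc k)\<^sup>2))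
    = (\<Sum>j\<le>n. of_real (a j) * s j) * (1 - of_real r * (2 * cos (2 * z)) + of_real (r\<^sup>2))"
    unfolding prod.lessThan_Suc
    by (subst mult.assoc[symmetric], subst Suc.IH) (simp only: a_def s_def r_def of_real_power)
  also have "\<dots> = (1 + of_real (r\<^sup>2)) * (\<Sum>j\<le>n. of_real (a j) * s j)
      - of_real r * ((\<Sum>j\<le>n. of_real (a j) * s j) * (2 * cos (2 * z)))"
    by (simp add: algebra_simps)
  also have "(\<Sum>j\<le>n. of_real (a j) * s j) * (2 * cos (2 * z)) =
      (\<Sum>j\<le>Suc n. of_real (a (Suc j) + b j) * s j)"
    unfolding s_def b_def by (rule sum_odd_sin_times_cos) (simp_all add: a0)
  also have "(\<Sum>j\<le>n. of_real (a j) * s j) = (\<Sum>j\<le>Suc n. of_real (a j) * s j)"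
    by (simp add: a0)
  also have "(1 + of_real (r\<^sup>2)) * (\<Sum>j\<le>Suc n. of_real (a j) * s j)
      - of_real r * (\<Sum>j\<le>Suc n. of_real (a (Suc j) + b j) * s j)
    = (\<Sum>j\<le>Suc n. of_real ((1 + r\<^sup>2) * a j - r * (a (Suc j) + b j)) * s j)"
    unfolding sum_distrib_left sum_subtractf[symmetric]
    by (intro sum.cong refl) (simp add: algebra_simps)
  also have "\<dots> = (\<Sum>j\<le>Suc n. of_real (theta_coeff q (Suc n) j) * s j)"
  proof (intro sum.cong refl)
    fix j assume "j \<in> {..Suc n}"
    moreover have "(q\<^sup>2) ^ (2 * Suc n) = r\<^sup>2"
      by (simp only: r_def mult.commute[of 2] power_mult)
    ultimately have "theta_coeff q (Suc n) j = (1 + r\<^sup>2) * a j - r * (a (Suc j) + b j)"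
      using theta_coeff_rec[OF q, of j n] unfolding a_def b_def r_def[symmetric] by simp
    then show "of_real ((1 + r\<^sup>2) * a j - r * (a (Suc j) + b j)) * s j
      = of_real (theta_coeff q (Suc n) j) * s j" by simp
  qed
  finally show ?case by (simp add: s_def)
qed

section \<open>Passage to the limit: the infinite product for theta_1\<close>

text \<open>The term is e^c times the \<open>j\<close>-th power of q^(j+1) e^(2c), and this base
  eventually drops below 1/2. The series is the majorant for Tannery's theorem.\<close>

lemma summable_gaussian_exp:
  fixes q c :: real
  assumes q: "0 < q" "q < 1"
  shows "summable (\<lambda>j. q ^ (j * (j + 1)) * exp (real (2 * j + 1) * c))"
proof -
  have "(\<lambda>j. q ^ (j + 1) * exp (2 * c)) \<longlonglongrightarrow> 0 * exp (2 * c)"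
    using q by (intro tendsto_mult_right LIMSEQ_ignore_initial_segment LIMSEQ_realpow_zero) auto
  then have "\<forall>\<^sub>F j in sequentially. q ^ (j + 1) * exp (2 * c) < 1 / 2"
    by (rule order_tendstoD) simp
  then have "\<forall>\<^sub>F j in sequentially.
      norm (q ^ (j * (j + 1)) * exp (real (2 * j + 1) * c)) \<le> exp c * (1 / 2) ^ j"
  proof eventually_elim
    case (elim j)
    have "exp (real (2 * j + 1) * c) = exp (c + real j * (2 * c))"
      by (simp add: algebra_simps)
    also have "\<dots> = exp c * exp (2 * c) ^ j"
      by (simp only: exp_add exp_of_nat_mult)
    finally have e: "exp (real (2 * j + 1) * c) = exp c * exp (2 * c) ^ j" .
    have "q ^ (j * (j + 1)) = (q ^ (j + 1)) ^ j"
      by (subst mult.commute) (rule power_mult)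
    then have "q ^ (j * (j + 1)) * exp (real (2 * j + 1) * c) = exp c * (q ^ (j + 1) * exp (2 * c)) ^ j"
      unfolding e by (simp only: power_mult_distrib mult_ac)
    moreover have "(q ^ (j + 1) * exp (2 * c)) ^ j \<le> (1 / 2) ^ j"
      using elim q by (intro power_mono) auto
    ultimately show ?case using q by simp
  qed
  then show ?thesis
    by (rule summable_comparison_test_ev) (intro summable_mult summable_geometric, simp)
qed

lemma powr_half_integer_square:
  fixes q :: real
  assumes "0 < q"
  shows "q powr ((real n + 1/2)\<^sup>2) = q powr (1/4) * q ^ (n * (n + 1))"
proof -
  have "(real n + 1/2)\<^sup>2 = 1/4 + real (n * (n + 1))"
    by (simp add: power2_eq_square algebra_simps)
  then show ?thesis
    using assms by (simp only: powr_add powr_realpow)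
qed

lemma norm_sin_le: "norm (sin z) \<le> exp (norm z)" for z :: complex
proof -
  have "norm (exp (\<i> * z) - exp (- (\<i> * z))) \<le> norm (exp (\<i> * z)) + norm (exp (- (\<i> * z)))"
    by (rule norm_triangle_ineq4)
  also have "\<dots> \<le> exp (norm z) + exp (norm z)"
    using abs_Im_le_cmod[of z] by (intro add_mono) (simp_all add: abs_le_iff)
  finally show ?thesis by (simp add: sin_exp_eq norm_divide norm_mult)
qed

text \<open>Let \<open>n\<close> grow in \<open>finite_theta_product\<close>: the product side is
  already the sequence in question, and on the sine side Tannery's theorem exchanges limit and sum.
  The constant does not depend on \<open>z\<close>, hence the order of quantifiers.\<close>

lemma jacobi_theta1_product:
  fixes q :: real
  assumes q: "0 < q" "q < 1"
  shows "\<exists>K>0. \<forall>z. (\<lambda>n. of_real K * (sin z *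
      (\<Prod>k<n. 1 - of_real ((q\<^sup>2) ^ Suc k) * (2 * cos (2 * z)) + of_real (((q\<^sup>2) ^ Suc k)\<^sup>2))))
    \<longlonglongrightarrow> jacobi_theta1 z q"
proof -
  have x: "0 < q\<^sup>2" "q\<^sup>2 < 1"
    using q by (auto simp: power_less_one_iff)
  obtain L where L: "0 < L" "q_pochhammer (q\<^sup>2) \<longlonglongrightarrow> L" "\<And>n. L \<le> q_pochhammer (q\<^sup>2) n"
    using q_pochhammer_limit[OF x] by blast
  \<comment> \<open>2 and q^(1/4) come from the series of theta_1, and \<open>L\<close> cancels the
    limit \<open>1 / L\<close> of the Gaussian binomials.\<close>
  define K where "K = 2 * q powr (1/4) * L"
  have lim: "(\<lambda>n. of_real K * (sin z *
      (\<Prod>k<n. 1 - of_real ((q\<^sup>2) ^ Suc k) * (2 * cos (2 * z)) + of_real (((q\<^sup>2) ^ Suc k)\<^sup>2))))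
    \<longlonglongrightarrow> jacobi_theta1 z q" for z
  proof -
    define s where "s j = sin (of_nat (2 * j + 1) * z)" for j
    define f where "f j n = of_real (theta_coeff q n j) * s j" for j n
    define b where "b j = of_real ((-1) ^ j * q ^ (j * (j + 1)) * (1 / L)) * s j" for j
    \<comment> \<open>Independent of \<open>n\<close>: \<open>1 / L\<^sup>2\<close> bounds the
      binomial and the exponential bounds the sine.\<close>
    define M where "M j = 1 / L\<^sup>2 * (q ^ (j * (j + 1)) * exp (real (2 * j + 1) * norm z))" for j
    have lim_f: "f j \<longlonglongrightarrow> b j" for j
      unfolding f_def b_def theta_coeff_def
      by (intro tendsto_intros odd_q_binomial_LIMSEQ[OF x] L)
    have bound: "norm (f j n) \<le> M j" for j n
    proof -
      have s: "norm (s j) \<le> exp (real (2 * j + 1) * norm z)"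
        using norm_sin_le[of "of_nat (2 * j + 1) * z"] by (simp only: s_def norm_mult norm_of_nat)
      have "q ^ (j * (j + 1)) * \<bar>odd_q_binomial (q\<^sup>2) n j\<bar> \<le> q ^ (j * (j + 1)) * (1 / L\<^sup>2)"
        using q by (intro mult_left_mono odd_q_binomial_bound[OF x L(1,3)]) auto
      then have "\<bar>theta_coeff q n j\<bar> \<le> q ^ (j * (j + 1)) * (1 / L\<^sup>2)"
        using q by (simp add: theta_coeff_def abs_mult)
      with s have "\<bar>theta_coeff q n j\<bar> * norm (s j)
          \<le> (q ^ (j * (j + 1)) * (1 / L\<^sup>2)) * exp (real (2 * j + 1) * norm z)"
        by (intro mult_mono) auto
      then show ?thesis by (simp add: f_def M_def norm_mult mult_ac)
    qed
    have "summable M"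
      unfolding M_def by (intro summable_mult summable_gaussian_exp q)
    have "\<forall>\<^sub>F (k, n) in sequentially \<times>\<^sub>F sequentially. norm (f k n) \<le> M k"
      using bound by (intro always_eventually) auto
    note tannery = tannerys_theorem[OF lim_f this \<open>summable M\<close> sequentially_bot]
    have "(\<lambda>n. \<Sum>j. f j n) \<longlonglongrightarrow> (\<Sum>j. b j)"
      by (rule tannery[THEN conjunct2, THEN conjunct2])
    moreover have "(\<Sum>j. f j n) = sin z *
        (\<Prod>k<n. 1 - of_real ((q\<^sup>2) ^ Suc k) * (2 * cos (2 * z)) + of_real (((q\<^sup>2) ^ Suc k)\<^sup>2))" for n
    proof -
      \<comment> \<open>For \<open>n < j\<close> the term is 0 by the default value of
        \<open>odd_q_binomial\<close>.\<close>
      have "(\<Sum>j. f j n) = (\<Sum>j\<le>n. f j n)"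
        by (rule suminf_finite) (auto simp: f_def theta_coeff_def odd_q_binomial_def)
      then show ?thesis
        unfolding finite_theta_product[OF q] by (simp add: f_def s_def)
    qed
    ultimately have "(\<lambda>n. sin z *
        (\<Prod>k<n. 1 - of_real ((q\<^sup>2) ^ Suc k) * (2 * cos (2 * z)) + of_real (((q\<^sup>2) ^ Suc k)\<^sup>2)))
      \<longlonglongrightarrow> (\<Sum>j. b j)" by simp
    then have "(\<lambda>n. of_real K * (sin z *
        (\<Prod>k<n. 1 - of_real ((q\<^sup>2) ^ Suc k) * (2 * cos (2 * z)) + of_real (((q\<^sup>2) ^ Suc k)\<^sup>2))))
      \<longlonglongrightarrow> of_real K * (\<Sum>j. b j)"
      by (rule tendsto_mult_left)
    moreover have "of_real K * (\<Sum>j. b j) = jacobi_theta1 z q"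
    proof -
      have "summable b"
        by (rule summable_norm_cancel) (rule tannery[THEN conjunct2, THEN conjunct1])
      have "jacobi_theta1 z q = 2 * (\<Sum>j. of_real (q powr (1/4) * L) * b j)"
        unfolding jacobi_theta1_def powr_half_integer_square[OF q(1)] b_def s_def using L
        by (intro arg_cong[where f = "(*) 2"] suminf_cong) (simp add: mult_ac)
      also have "\<dots> = of_real K * (\<Sum>j. b j)"
        unfolding suminf_mult[OF \<open>summable b\<close>] by (simp add: K_def)
      finally show ?thesis by simp
    qed
    ultimately show ?thesis by simp
  qed
  show ?thesis
  proof (rule exI[of _ K], rule conjI)
    show "K > 0" using L q by (simp add: K_def)
  qed (rule allI, rule lim)
qed

section \<open>From theta_2 to theta_1, and the squared modulus as a real product\<close>

text \<open>Shifting by pi/2 turns sin((2n+1)z) into (-1)^n cos((2n+1)z), which cancels the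
  alternating sign. The series agree term by term, so convergence is not an issue.\<close>

lemma jacobi_theta2_eq_theta1: "jacobi_theta2 z q = jacobi_theta1 (z + of_real (pi / 2)) q"
proof -
  have cos_shift: "cos (w + of_nat n * of_real pi) = (-1) ^ n * cos w" for w :: complex and n
  proof (induction n)
    case (Suc n)
    have "cos (w + of_nat (Suc n) * of_real pi) = cos ((w + of_nat n * of_real pi) + of_real pi)"
      by (simp add: algebra_simps)
    also have "\<dots> = - cos (w + of_nat n * of_real pi)"
      by (simp only: cos_add) (simp flip: cos_of_real sin_of_real)
    finally show ?case using Suc by simp
  qed simp
  have "(-1) ^ n * p * sin (of_nat (2 * n + 1) * (z + of_real (pi / 2))) = p * cos (of_nat (2 * n + 1) * z)"
    for n and p :: complex
  proof -
    have "of_nat (2 * n + 1) * (z + of_real (pi / 2))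
        = (of_nat (2 * n + 1) * z + of_nat n * of_real pi) + of_real pi / 2"
      by (simp add: field_simps)
    then show ?thesis
      by (simp only: sin_add sin_of_real_pi_half cos_of_real_pi_half cos_shift) simp
  qed
  then show ?thesis
    unfolding jacobi_theta1_def jacobi_theta2_def by (simp only:)
qed

text \<open>Half of the factors of \<open>|\<theta>\<^sub>1((X + iu)/2)|\<^sup>2\<close>, with \<open>s = e\<^sup>u\<close> or \<open>s = e\<^sup>-\<^sup>u\<close>,
  \<open>c = cos X\<close> and \<open>x = q\<^sup>2\<close>.\<close>

definition theta_factor :: "real \<Rightarrow> real \<Rightarrow> real \<Rightarrow> nat \<Rightarrow> real" where
  "theta_factor x s c k = 1 - 2 * (s * x ^ Suc k) * c + (s * x ^ Suc k)\<^sup>2"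

text \<open>Completing the square leaves 1 - c^2, which is positive whatever \<open>x\<close> and
  \<open>s\<close> are.\<close>

lemma theta_factor_pos:
  assumes "\<bar>c\<bar> < 1"
  shows "0 < theta_factor x s c k"
proof -
  have "theta_factor x s c k = (s * x ^ Suc k - c)\<^sup>2 + (1 - c\<^sup>2)"
    by (simp add: theta_factor_def power2_eq_square algebra_simps)
  moreover have "c\<^sup>2 < 1" using assms by (simp add: abs_square_less_1)
  ultimately show ?thesis by (simp add: add_nonneg_pos)
qed

lemma convergent_prod_theta_factor:
  assumes x: "0 < x" "x < 1" and c: "\<bar>c\<bar> < 1"
  shows "convergent_prod (theta_factor x s c)"
proof -
  define z where "z k = - 2 * (s * x ^ Suc k) * c + (s * x ^ Suc k)\<^sup>2" for k
  have "x\<^sup>2 < 1" using x by (simp add: power_less_one_iff)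
  have eq: "theta_factor x s c k = 1 + z k" for k
    by (simp add: theta_factor_def z_def)
  have "summable (\<lambda>k. \<bar>z k\<bar>)"
  proof (rule summable_comparison_test'[where N = 0])
    \<comment> \<open>A geometric series in \<open>x\<close> for the linear term and one in x^2 for
      the square.\<close>
    show "summable (\<lambda>k. 2 * \<bar>s * c\<bar> * x * x ^ k + s\<^sup>2 * x\<^sup>2 * (x\<^sup>2) ^ k)"
      using x \<open>x\<^sup>2 < 1\<close> by (intro summable_add summable_mult summable_geometric) auto
    show "norm \<bar>z k\<bar> \<le> 2 * \<bar>s * c\<bar> * x * x ^ k + s\<^sup>2 * x\<^sup>2 * (x\<^sup>2) ^ k" for k
    proof -
      have "\<bar>z k\<bar> \<le> \<bar>- 2 * (s * x ^ Suc k) * c\<bar> + \<bar>(s * x ^ Suc k)\<^sup>2\<bar>"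
        unfolding z_def by (rule abs_triangle_ineq)
      also have "\<dots> = 2 * \<bar>s * c\<bar> * x * x ^ k + s\<^sup>2 * x\<^sup>2 * (x\<^sup>2) ^ k"
        using x by (simp add: abs_mult power_mult_distrib power2_eq_square mult_ac)
      finally show ?thesis by simp
    qed
  qed
  moreover have "z k \<noteq> - 1" for k
    using theta_factor_pos[OF c, of x s k] by (simp add: eq)
  ultimately show ?thesis
    unfolding eq[abs_def] by (rule summable_imp_convergent_prod_real)
qed

lemma prodinf_theta_factor_pos:
  assumes "0 < x" "x < 1" "\<bar>c\<bar> < 1"
  shows "0 < prodinf (theta_factor x s c)"
  by (intro less_0_prodinf convergent_prod_theta_factor theta_factor_pos assms)

text \<open>Every factor is affine in \<open>c\<close> with slope
  \<open>- 2 * (s * x ^ Suc k)\<close>; positivity carries the comparison over to finite products,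
  and the limit preserves it.\<close>

lemma prodinf_theta_factor_antimono:
  assumes x: "0 < x" "x < 1" and c: "\<bar>c\<bar> < 1" "\<bar>d\<bar> < 1" "c \<le> d" and s: "0 \<le> s"
  shows "prodinf (theta_factor x s d) \<le> prodinf (theta_factor x s c)"
proof (rule LIMSEQ_le)
  show "(\<lambda>n. \<Prod>k\<le>n. theta_factor x s d k) \<longlonglongrightarrow> prodinf (theta_factor x s d)"
    "(\<lambda>n. \<Prod>k\<le>n. theta_factor x s c k) \<longlonglongrightarrow> prodinf (theta_factor x s c)"
    by (intro convergent_prod_LIMSEQ convergent_prod_theta_factor x c)+
  have "theta_factor x s d k \<le> theta_factor x s c k" for k
    using x c s by (simp add: theta_factor_def mult_left_mono)
  then have "(\<Prod>k\<le>n. theta_factor x s d k) \<le> (\<Prod>k\<le>n. theta_factor x s c k)" for n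
    using theta_factor_pos[OF c(2), of x s] by (intro prod_mono) (auto intro: less_imp_le)
  then show "\<exists>N. \<forall>n\<ge>N. (\<Prod>k\<le>n. theta_factor x s d k) \<le> (\<Prod>k\<le>n. theta_factor x s c k)"
    by blast
qed

lemma norm_one_minus_cis_sq: "(cmod (1 - of_real r * cis t))\<^sup>2 = 1 - 2 * r * cos t + r\<^sup>2"
proof -
  have "(cmod (1 - of_real r * cis t))\<^sup>2 = (1 - r * cos t)\<^sup>2 + (r * sin t)\<^sup>2"
    by (simp add: cmod_power2)
  also have "\<dots> = 1 - 2 * r * cos t + r\<^sup>2 * ((sin t)\<^sup>2 + (cos t)\<^sup>2)"
    by (simp only: power2_eq_square) algebra
  finally show ?thesis by simp
qed

text \<open>With w = e^(i(X+iu)) the factor splits as (1 - r w)(1 - r / w). Since w has modulus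
  e^(-u) and argument \<open>X\<close>, the squared moduli of the two parts are the two real
  quadratics.\<close>

lemma norm_theta_factor_sq:
  "(cmod (1 - of_real r * (2 * cos (Complex X u)) + of_real (r\<^sup>2)))\<^sup>2 =
    (1 - 2 * (exp u * r) * cos X + (exp u * r)\<^sup>2) * (1 - 2 * (exp (- u) * r) * cos X + (exp (- u) * r)\<^sup>2)"
proof -
  let ?a = "exp (\<i> * Complex X u)"
  have "?a * exp (- (\<i> * Complex X u)) = 1"
    by (simp flip: exp_add)
  then have "1 - of_real r * (2 * cos (Complex X u)) + of_real (r\<^sup>2) =
      (1 - of_real r * ?a) * (1 - of_real r * exp (- (\<i> * Complex X u)))"
    by (simp add: cos_exp_eq algebra_simps power2_eq_square)
  also have "?a = of_real (exp (- u)) * cis X"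
    by (simp add: exp_eq_polar)
  also have "exp (- (\<i> * Complex X u)) = of_real (exp u) * cis (- X)"
    by (simp add: exp_eq_polar)
  finally have "1 - of_real r * (2 * cos (Complex X u)) + of_real (r\<^sup>2) =
      (1 - of_real (exp (- u) * r) * cis X) * (1 - of_real (exp u * r) * cis (- X))"
    by (simp add: mult_ac)
  then show ?thesis
    by (simp only: norm_mult power_mult_distrib norm_one_minus_cis_sq) (simp add: mult_ac)
qed

text \<open>Only sign and monotonicity of \<open>F\<close> are exported, so the infinite product
  never has to be differentiated. The factor \<open>cosh u - cos X\<close> is twice the squared
  modulus of sin((X+iu)/2), which is where the 1/2 in \<open>F\<close> comes from.\<close>

lemma jacobi_theta1_norm_sq:
  fixes q :: real
  assumes q: "0 < q" "q < 1"
  obtains F :: "real \<Rightarrow> real \<Rightarrow> real"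
  where "\<And>u c. \<bar>c\<bar> < 1 \<Longrightarrow> 0 < F u c"
    and "\<And>u c d. \<bar>c\<bar> < 1 \<Longrightarrow> \<bar>d\<bar> < 1 \<Longrightarrow> c \<le> d \<Longrightarrow> F u d \<le> F u c"
    and "\<And>u X. \<bar>cos X\<bar> < 1 \<Longrightarrow>
      (cmod (jacobi_theta1 (Complex X u / 2) q))\<^sup>2 = (cosh u - cos X) * F u (cos X)"
proof -
  define x where "x = q\<^sup>2"
  have x: "0 < x" "x < 1"
    using q by (auto simp: x_def power_less_one_iff)
  obtain K where K: "K > 0" and lim: "\<And>z. (\<lambda>n. of_real K * (sin z *
      (\<Prod>k<n. 1 - of_real (x ^ Suc k) * (2 * cos (2 * z)) + of_real ((x ^ Suc k)\<^sup>2))))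
    \<longlonglongrightarrow> jacobi_theta1 z q"
    using jacobi_theta1_product[OF q, folded x_def] by blast
  define F where "F u c = K\<^sup>2 / 2 *
    (prodinf (theta_factor x (exp u) c) * prodinf (theta_factor x (exp (- u)) c))" for u c
  note conv = convergent_prod_theta_factor[OF x]
  show ?thesis
  proof
    show "0 < F u c" if "\<bar>c\<bar> < 1" for u c
      unfolding F_def using K by (intro mult_pos_pos prodinf_theta_factor_pos x that) auto
    show "F u d \<le> F u c" if "\<bar>c\<bar> < 1" "\<bar>d\<bar> < 1" "c \<le> d" for u c d
      unfolding F_def using K that
      by (intro mult_left_mono mult_mono prodinf_theta_factor_antimono x)
        (auto intro: less_imp_le prodinf_theta_factor_pos x)
    show "(cmod (jacobi_theta1 (Complex X u / 2) q))\<^sup>2 = (cosh u - cos X) * F u (cos X)"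
      if c: "\<bar>cos X\<bar> < 1" for u X
    proof -
      define z where "z = Complex X u / 2"
      have z2: "2 * z = Complex X u" by (simp add: z_def)
      have sin_z: "(cmod (sin z))\<^sup>2 = (cosh u - cos X) / 2"
        unfolding norm_sin_squared by (simp add: z_def cosh_def exp_minus field_simps)
      have A: "(\<lambda>n. (cmod (of_real K * (sin z *
          (\<Prod>k<n. 1 - of_real (x ^ Suc k) * (2 * cos (2 * z)) + of_real ((x ^ Suc k)\<^sup>2)))))\<^sup>2)
        \<longlonglongrightarrow> (cmod (jacobi_theta1 z q))\<^sup>2"
        by (intro tendsto_intros lim)
      have B: "(cmod (of_real K * (sin z *
          (\<Prod>k<n. 1 - of_real (x ^ Suc k) * (2 * cos (2 * z)) + of_real ((x ^ Suc k)\<^sup>2)))))\<^sup>2 =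
        K\<^sup>2 * ((cosh u - cos X) / 2 * ((\<Prod>k<n. theta_factor x (exp u) (cos X) k) *
          (\<Prod>k<n. theta_factor x (exp (- u)) (cos X) k)))" for n
        unfolding norm_mult power_mult_distrib sin_z z2 prod_norm[symmetric]
          prod_power_distrib norm_theta_factor_sq prod.distrib theta_factor_def
        by simp
      have C: "(\<lambda>n. K\<^sup>2 * ((cosh u - cos X) / 2 * ((\<Prod>k<n. theta_factor x (exp u) (cos X) k) *
          (\<Prod>k<n. theta_factor x (exp (- u)) (cos X) k))))
        \<longlonglongrightarrow> K\<^sup>2 * ((cosh u - cos X) / 2 * (prodinf (theta_factor x (exp u) (cos X)) *
          prodinf (theta_factor x (exp (- u)) (cos X))))"
        using convergent_prod_LIMSEQ[OF conv[OF c]]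
        by (intro tendsto_intros) (simp_all add: LIMSEQ_lessThan_iff_atMost)
      have "(cmod (jacobi_theta1 z q))\<^sup>2 =
          K\<^sup>2 * ((cosh u - cos X) / 2 * (prodinf (theta_factor x (exp u) (cos X)) *
            prodinf (theta_factor x (exp (- u)) (cos X))))"
        by (rule LIMSEQ_unique[OF A[unfolded B] C])
      then show ?thesis by (simp add: z_def F_def mult_ac)
    qed
  qed
qed

section \<open>Monotonicity in cos X and the critical points\<close>

lemma abs_cos_less_one:
  assumes "sin t \<noteq> (0::real)"
  shows "\<bar>cos t\<bar> < 1"
proof -
  have "0 < (sin t)\<^sup>2" using assms by simp
  then show ?thesis
    unfolding abs_square_less_1[symmetric] using sin_cos_squared_add[of t] by linarith
qed

text \<open>Replaces the chain rule, as \<open>m\<close> need not be differentiable. On (0, pi) the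
  cosine decreases, so \<open>f\<close> does too and \<open>D\<close> is at most 0; on (-pi, 0) both
  increase.\<close>

lemma mono_comp_cos_deriv:
  assumes mono: "mono_on {-1<..<1} m"
    and eq: "\<And>t. sin t \<noteq> 0 \<Longrightarrow> f t = m (cos t)"
    and deriv: "(f has_real_derivative D) (at X)"
    and X: "-pi < X" "X < pi" "X \<noteq> 0"
  shows "D * sin X \<le> 0"
proof -
  have mono': "m (cos s) \<le> m (cos t)" if "cos s \<le> cos t" "sin s \<noteq> 0" "sin t \<noteq> 0" for s t
    using abs_cos_less_one[OF that(2)] abs_cos_less_one[OF that(3)] that(1)
    by (intro mono_onD[OF mono]) auto
  show ?thesis
  proof (cases "0 < X")
    case True
    have "mono_on {0<..<pi} (\<lambda>t. - f t)"
    proof (rule mono_onI)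
      fix s t assume *: "s \<in> {0<..<pi}" "t \<in> {0<..<pi}" "s \<le> t"
      then have "sin s \<noteq> 0" "sin t \<noteq> 0" using sin_gt_zero[of s] sin_gt_zero[of t] by auto
      then show "- f s \<le> - f t"
        using * by (simp add: eq mono' cos_monotone_0_pi_le)
    qed
    moreover have "((\<lambda>t. - f t) has_real_derivative - D) (at X)"
      by (intro derivative_intros deriv)
    ultimately have "0 \<le> - D"
      by (rule mono_on_imp_deriv_nonneg) (use True X in auto)
    moreover have "0 < sin X" using True X by (simp add: sin_gt_zero)
    ultimately show ?thesis by (simp add: mult_nonpos_nonneg)
  next
    case False
    have neg: "sin s < 0" if "- pi < s" "s < 0" for s
      using sin_gt_zero[of "- s"] that by simp
    have "mono_on {-pi<..<0} f"
    proof (rule mono_onI)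
      fix s t assume *: "s \<in> {-pi<..<0}" "t \<in> {-pi<..<0}" "s \<le> t"
      then have "sin s \<noteq> 0" "sin t \<noteq> 0" using neg[of s] neg[of t] by auto
      moreover have "cos s \<le> cos t"
        using cos_monotone_0_pi_le[of "- t" "- s"] * by simp
      ultimately show "f s \<le> f t" by (simp add: eq mono')
    qed
    from this deriv have "0 \<le> D"
      by (rule mono_on_imp_deriv_nonneg) (use False X in auto)
    moreover have "sin X < 0" using False X by (intro neg) auto
    ultimately show ?thesis by (simp add: mult_nonneg_nonpos)
  qed
qed

theorem lemma5p10:
  fixes \<Gamma>\<^sub>1 \<Gamma>\<^sub>2 C q X y\<^sub>1 :: real
  assumes "\<Gamma>\<^sub>1 > \<Gamma>\<^sub>2" and "\<Gamma>\<^sub>2 > 0"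
    and "q = exp (- pi / 2)"
    and "X \<in> {-pi..pi}"
    and "reduced_critical_point q \<Gamma>\<^sub>1 \<Gamma>\<^sub>2 C X y\<^sub>1"
  shows "X = 0 \<or> X = pi \<or> X = - pi"
proof (rule ccontr)
  assume "\<not> ?thesis"
  then have X: "-pi < X" "X < pi" "X \<noteq> 0" using assms(4) by auto
  then have sin_X: "sin X \<noteq> 0"
    using sin_gt_zero[of X] sin_gt_zero[of "- X"] by (cases "0 < X") auto
  have "0 < q" "q < 1" using assms(3) by auto
  then obtain F where F_pos: "\<And>u c. \<bar>c\<bar> < 1 \<Longrightarrow> 0 < F u c"
    and F_anti: "\<And>u c d. \<bar>c\<bar> < 1 \<Longrightarrow> \<bar>d\<bar> < 1 \<Longrightarrow> c \<le> d \<Longrightarrow> F u d \<le> F u c"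
    and F: "\<And>u X. \<bar>cos X\<bar> < 1 \<Longrightarrow>
      (cmod (jacobi_theta1 (Complex X u / 2) q))\<^sup>2 = (cosh u - cos X) * F u (cos X)"
    using jacobi_theta1_norm_sq by blast
  define y\<^sub>2 where "y\<^sub>2 = reduced_y2 \<Gamma>\<^sub>1 \<Gamma>\<^sub>2 C y\<^sub>1"
  define u where "u = y\<^sub>1 - y\<^sub>2"
  define v where "v = y\<^sub>1 + y\<^sub>2"
  define K where "K = \<Gamma>\<^sub>1 * \<Gamma>\<^sub>2 / (2 * pi)"
  have K: "0 < K" using assms(1,2) by (simp add: K_def)
  define H where "H t = reduced_hamiltonian q \<Gamma>\<^sub>1 \<Gamma>\<^sub>2 C t y\<^sub>1" for t
  define E where "E = - (\<Gamma>\<^sub>1 * \<Gamma>\<^sub>2 / pi\<^sup>2) * y\<^sub>1 * y\<^sub>2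
     + (\<Gamma>\<^sub>1\<^sup>2 / (4 * pi)) *
         (ln (cmod (jacobi_theta1 (\<i> * of_real y\<^sub>1 - of_real (pi / 2)) q)) - 2 * y\<^sub>1\<^sup>2 / pi)
     + (\<Gamma>\<^sub>2\<^sup>2 / (4 * pi)) *
         (ln (cmod (jacobi_theta1 (\<i> * of_real y\<^sub>2 - of_real (pi / 2)) q)) - 2 * y\<^sub>2\<^sup>2 / pi)"
  \<comment> \<open>Everything in the Hamiltonian that increases with c = cos t; the remaining
    logarithm, of \<open>cosh u - cos t\<close>, is differentiated explicitly and therefore added
    back in \<open>f\<close>.\<close>
  define m where "m c = K / 2 * (ln (cosh v + c) + ln (F v (- c)) - ln (F u c)) + E" for c
  define f where "f t = H t + K / 2 * ln (cosh u - cos t)" for t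
  have cosh_gt: "c < cosh w" if "\<bar>c\<bar> < 1" for c w :: real
    using cosh_real_ge_1[of w] that by linarith
  have ln_theta1: "ln (cmod (jacobi_theta1 (Complex t w / 2) q))
      = (ln (cosh w - cos t) + ln (F w (cos t))) / 2" if "\<bar>cos t\<bar> < 1" for t w
  proof -
    let ?N = "cmod (jacobi_theta1 (Complex t w / 2) q)"
    have pos: "0 < cosh w - cos t" "0 < F w (cos t)"
      using cosh_gt[OF that, of w] F_pos[OF that] by simp_all
    then have "0 < ?N\<^sup>2" by (simp add: F[OF that])
    then have "?N > 0" by (simp only: zero_less_power2 norm_ge_zero zero_less_norm_iff) simp
    then have "2 * ln ?N = ln (?N\<^sup>2)" by (simp add: ln_realpow)
    also have "\<dots> = ln (cosh w - cos t) + ln (F w (cos t))"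
      using pos by (simp add: F[OF that] ln_mult)
    finally show ?thesis by simp
  qed
  have f_eq: "f t = m (cos t)" if "sin t \<noteq> 0" for t
  proof -
    note c = abs_cos_less_one[OF that]
    \<comment> \<open>Shifting the argument by pi/2 shifts \<open>t\<close> by pi and so replaces
      cos t by -cos t, which reverses the monotonicity of the theta_2 term.\<close>
    have "Complex t v / 2 + of_real (pi / 2) = Complex (t + pi) v / 2"
      by (simp add: complex_eq_iff add_divide_distrib)
    then have "jacobi_theta2 (Complex t v / 2) q = jacobi_theta1 (Complex (t + pi) v / 2) q"
      by (simp only: jacobi_theta2_eq_theta1)
    moreover have "ln (cmod (jacobi_theta1 (Complex (t + pi) v / 2) q))
        = (ln (cosh v + cos t) + ln (F v (- cos t))) / 2"
      using ln_theta1[of "t + pi" v] c by simp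
    moreover have "H t = - K * ln (cmod (jacobi_theta1 (Complex t u / 2) q))
        + K * ln (cmod (jacobi_theta2 (Complex t v / 2) q)) + E"
      unfolding H_def reduced_hamiltonian_def klein_hamiltonian_def E_def
        y\<^sub>2_def[symmetric] u_def v_def K_def by simp
    ultimately show ?thesis
      unfolding f_def m_def by (simp add: ln_theta1[OF c] field_simps)
  qed
  have m_mono: "mono_on {-1<..<1} m"
  proof (rule mono_onI)
    fix c d :: real assume *: "c \<in> {-1<..<1}" "d \<in> {-1<..<1}" "c \<le> d"
    then have cd: "\<bar>c\<bar> < 1" "\<bar>d\<bar> < 1" "\<bar>- c\<bar> < 1" "\<bar>- d\<bar> < 1" by auto
    have "0 < cosh v + c" using cosh_gt[OF cd(3), of v] by simp
    moreover have "F u d \<le> F u c" "F v (- c) \<le> F v (- d)"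
      using * by (auto intro!: F_anti)
    ultimately have "ln (cosh v + c) \<le> ln (cosh v + d)" "ln (F v (- c)) \<le> ln (F v (- d))"
      "ln (F u d) \<le> ln (F u c)"
      using * F_pos cd by (auto intro!: ln_mono)
    then show "m c \<le> m d" unfolding m_def using K by (intro add_right_mono mult_left_mono) auto
  qed
  have pos: "0 < cosh u - cos X"
    using cosh_gt[OF abs_cos_less_one[OF sin_X], of u] by simp
  have H_deriv: "(H has_real_derivative 0) (at X)"
    using assms(5) unfolding reduced_critical_point_def H_def by blast
  have "((\<lambda>t. ln (cosh u - cos t)) has_real_derivative sin X / (cosh u - cos X)) (at X)"
    using pos by (auto intro!: derivative_eq_intros)
  then have f_deriv: "(f has_real_derivative 0 + K / 2 * (sin X / (cosh u - cos X))) (at X)"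
    unfolding f_def by (intro DERIV_add DERIV_cmult H_deriv)
  \<comment> \<open>As \<open>H\<close> has derivative 0 at \<open>X\<close>, the derivative of
    \<open>f\<close> is that of the added logarithm. It has the sign of sin X, whereas monotonicity
    of \<open>m\<close> forces the opposite sign or 0.\<close>
  have "(0 + K / 2 * (sin X / (cosh u - cos X))) * sin X \<le> 0"
    by (rule mono_comp_cos_deriv[OF m_mono _ f_deriv X]) (rule f_eq)
  moreover have "K / 2 * (sin X / (cosh u - cos X)) * sin X = K / 2 * ((sin X)\<^sup>2 / (cosh u - cos X))"
    by (simp add: power2_eq_square)
  moreover have "0 < K / 2 * ((sin X)\<^sup>2 / (cosh u - cos X))"
    using K pos sin_X by simp
  ultimately show False by (metis add_0_left not_less)
qed

end
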